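(* Every real cosymplectic vector space $(V,b,\psi)$ of dimension $2n+1$ is cosymplectomorphic to $\mathbb{R}^{2n+1}$ with the standard cosymplectic structure $(b_0,\psi_0)$; that is, there is a linear isomorphism $B:V\to\mathbb{R}^{2n+1}$ with $B^*b_0=b$ and $B^*\psi_0=\psi$.
   Context: A cosymplectic vector space $(V,b,\psi)$ is a finite-dimensional real vector space $V$ with an antisymmetric bilinear form $b$ and a nonzero linear form $\psi$ such that $\widetilde I_{\psi,b}:V\to V^*$, $\widetilde I_{\psi,b}(v)(u)=b(v,u)+\psi(v)\psi(u)$, is bijective. The standard cosymplectic structure on $\mathbb{R}^{2n+1}$ with basis $\{e_1,\dots,e_n,f_1,\dots,f_n,\xi\}$ is: $b_0$ antisymmetric bilinear with $b_0(e_i,e_j)=0$, $b_0(f_i,f_j)=0$, $b_0(e_i,f_j)=\delta_{ij}$, $b_0(\xi,v)=0$ for all $v$; and $\psi_0$ linear with $\psi_0(\xi)=1$ and $\ker\psi_0=\mathrm{span}\{e_1,\dots,e_n,f_1,\dots,f_n\}$. *)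

theory Defs
  imports "HOL-Analysis.Linear_Algebra" "Jordan_Normal_Form.VS_Connect"
begin

text \<open>The vector space \<open>V\<close> is the whole type \<open>'a\<close>; its dual is the set \<open>{f. linear f}\<close> of
  linear maps \<open>'a \<Rightarrow> real\<close>.\<close>

definition cosymplectic_space ::
    "('a::real_vector \<Rightarrow> 'a \<Rightarrow> real) \<Rightarrow> ('a \<Rightarrow> real) \<Rightarrow> bool" where
  "cosymplectic_space b \<psi> \<longleftrightarrow>
     (\<exists>S::'a set. finite S \<and> span S = UNIV) \<and>
     bilinear b \<and> (\<forall>u v. b u v = - b v u) \<and>
     linear \<psi> \<and> (\<exists>v. \<psi> v \<noteq> 0) \<and>
     bij_betw (\<lambda>v u. b v u + \<psi> v * \<psi> u) UNIV {f. linear f}"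

text \<open>The space of real \<open>(2n+1)\<close>-tuples is \<open>carrier_vec (2 * n + 1) :: real vec set\<close>. Coordinates are
  counted from 0, and the basis is ordered as \<open>e\<^sub>1, \<dots>, e\<^sub>n, f\<^sub>1, \<dots>, f\<^sub>n, \<xi>\<close>, so that
  \<open>std_e n i\<close> and \<open>std_f n i\<close>, for \<open>i < n\<close>, are the basis vectors with number \<open>i + 1\<close>.\<close>

definition std_e :: "nat \<Rightarrow> nat \<Rightarrow> real vec" where
  "std_e n i = unit_vec (2 * n + 1) i"

definition std_f :: "nat \<Rightarrow> nat \<Rightarrow> real vec" where
  "std_f n i = unit_vec (2 * n + 1) (n + i)"

definition std_xi :: "nat \<Rightarrow> real vec" where
  "std_xi n = unit_vec (2 * n + 1) (2 * n)"

text \<open>Coordinate expressions of the standard structure. The lemmas below show that these are the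
  only forms with the defining values on the basis.\<close>

definition std_b :: "nat \<Rightarrow> real vec \<Rightarrow> real vec \<Rightarrow> real" where
  "std_b n u v = (\<Sum>i<n. u $ i * v $ (n + i) - u $ (n + i) * v $ i)"

definition std_psi :: "nat \<Rightarrow> real vec \<Rightarrow> real" where
  "std_psi n v = v $ (2 * n)"

definition linear_form_on_vec :: "nat \<Rightarrow> (real vec \<Rightarrow> real) \<Rightarrow> bool" where
  "linear_form_on_vec m g \<longleftrightarrow>
     (\<forall>u\<in>carrier_vec m. \<forall>v\<in>carrier_vec m. g (u + v) = g u + g v) \<and>
     (\<forall>c. \<forall>v\<in>carrier_vec m. g (c \<cdot>\<^sub>v v) = c * g v)"

definition bilinear_form_on_vec :: "nat \<Rightarrow> (real vec \<Rightarrow> real vec \<Rightarrow> real) \<Rightarrow> bool" where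
  "bilinear_form_on_vec m g \<longleftrightarrow>
     (\<forall>u\<in>carrier_vec m. linear_form_on_vec m (g u) \<and> linear_form_on_vec m (\<lambda>v. g v u))"

definition linear_iso_to_vec :: "nat \<Rightarrow> ('a::real_vector \<Rightarrow> real vec) \<Rightarrow> bool" where
  "linear_iso_to_vec m B \<longleftrightarrow>
     bij_betw B UNIV (carrier_vec m) \<and>
     (\<forall>u v. B (u + v) = B u + B v) \<and> (\<forall>c v. B (c *\<^sub>R v) = c \<cdot>\<^sub>v B v)"

lemma std_b_form:
  "bilinear_form_on_vec (2 * n + 1) (std_b n)"
  by (auto simp: bilinear_form_on_vec_def linear_form_on_vec_def std_b_def algebra_simps
      sum_distrib_left simp flip: sum.distrib intro!: sum.cong)

lemma std_b_antisym: "std_b n u v = - std_b n v u"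
  by (simp add: std_b_def mult.commute flip: sum_negf)

lemma std_b_basis:
  assumes "i < n" "j < n"
  shows "std_b n (std_e n i) (std_e n j) = 0"
    and "std_b n (std_f n i) (std_f n j) = 0"
    and "std_b n (std_e n i) (std_f n j) = (if i = j then 1 else 0)"
proof -
  show "std_b n (std_e n i) (std_e n j) = 0" "std_b n (std_f n i) (std_f n j) = 0"
    using assms by (auto simp: std_b_def std_e_def std_f_def intro!: sum.neutral)
  have "std_b n (std_e n i) (std_f n j) = (\<Sum>k<n. if k = i then (if i = j then 1 else 0) else 0)"
    unfolding std_b_def using assms
    by (intro sum.cong) (auto simp: std_e_def std_f_def)
  then show "std_b n (std_e n i) (std_f n j) = (if i = j then 1 else 0)"
    using assms by simp
qed

lemma std_b_xi: "std_b n (std_xi n) v = 0"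
  by (auto simp: std_b_def std_xi_def intro!: sum.neutral)

lemma std_psi_form:
  "linear_form_on_vec (2 * n + 1) (std_psi n)"
  by (auto simp: linear_form_on_vec_def std_psi_def)

lemma std_psi_xi: "std_psi n (std_xi n) = 1"
  by (simp add: std_psi_def std_xi_def)

lemma std_basis_eq:
  "set (unit_vecs (2 * n + 1)) = std_e n ` {..<n} \<union> std_f n ` {..<n} \<union> {std_xi n}"
proof -
  have "{0..<2 * n + 1} = {..<n} \<union> (\<lambda>i. n + i) ` {..<n} \<union> {2 * n}"
  proof (intro equalityI subsetI)
    fix k assume k: "k \<in> {0..<2 * n + 1}"
    consider "k < n" | "k = n + (k - n)" "k - n < n" | "k = 2 * n"
      using k by fastforce
    then show "k \<in> {..<n} \<union> (\<lambda>i. n + i) ` {..<n} \<union> {2 * n}"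
      by cases (blast, blast, simp)
  qed auto
  then show ?thesis
    unfolding unit_vecs_def set_map set_upt
    by (simp only: image_Un image_image image_insert image_empty std_e_def[abs_def]
        std_f_def[abs_def] std_xi_def)
qed

lemma std_psi_kernel:
  "{v \<in> carrier_vec (2 * n + 1). std_psi n v = 0} =
     LinearCombinations.module.span class_ring (module_vec TYPE(real) (2 * n + 1))
       (std_e n ` {..<n} \<union> std_f n ` {..<n})"
    (is "?K = _")
proof -
  interpret vec_space "TYPE(real)" "2 * n + 1" .
  let ?S = "std_e n ` {..<n} \<union> std_f n ` {..<n}"
  have S: "?S \<subseteq> carrier_vec (2 * n + 1)"
    by (auto simp: std_e_def std_f_def)
  have fin: "finite ?S" by simp
  have S0: "x $ (2 * n) = 0" if "x \<in> ?S" for x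
    using that by (auto simp: std_e_def std_f_def)
  have xi: "std_xi n \<notin> ?S"
    using S0[of "std_xi n"] by (auto simp: std_xi_def)
  have xic: "std_xi n \<in> carrier_vec (2 * n + 1)" by (simp add: std_xi_def)
  have "?K = span ?S"
  proof (intro equalityI subsetI)
    fix v assume "v \<in> ?K"
    then have v: "v \<in> carrier_vec (2 * n + 1)" and v0: "v $ (2 * n) = 0"
      by (auto simp: std_psi_def)
    have "v \<in> span (set (unit_vecs (2 * n + 1)))"
      using v span_unit_vecs_is_carrier by simp
    then obtain a where a: "v = lincomb a (set (unit_vecs (2 * n + 1)))"
      unfolding finite_span[OF finite_set unit_vecs_carrier] by auto
    have idx: "v $ i = (\<Sum>x\<in>?S. a x * x $ i) + a (std_xi n) * std_xi n $ i" if "i < 2 * n + 1" for i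
      proof -
      have "v $ i = (\<Sum>x\<in>insert (std_xi n) ?S. a x * x $ i)"
        unfolding a lincomb_index[OF that unit_vecs_carrier] unfolding std_basis_eq
        by (simp only: Un_insert_right Un_empty_right)
      then show ?thesis
        using xi fin by (simp add: add.commute)
    qed
    have "a (std_xi n) = 0"
      using idx[of "2 * n"] v0 S0 by (simp add: std_xi_def)
    then have "v $ i = lincomb a ?S $ i" if "i < 2 * n + 1" for i
      using idx[OF that] lincomb_index[OF that S] by simp
    then have "v = lincomb a ?S"
      using v lincomb_dim[OF fin S] by (intro eq_vecI) auto
    then show "v \<in> span ?S"
      unfolding finite_span[OF fin S] by auto
  next
    fix v assume "v \<in> span ?S"
    then obtain a where a: "v = lincomb a ?S"
      unfolding finite_span[OF fin S] by auto
    have "v $ (2 * n) = 0"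
      unfolding a using S0 by (subst lincomb_index[OF _ S]) (auto intro!: sum.neutral)
    then show "v \<in> ?K"
      using a lincomb_closed[OF S] by (simp add: std_psi_def)
  qed
  then show ?thesis .
qed

lemma linear_form_on_vec_eqI:
  assumes "linear_form_on_vec m g" "linear_form_on_vec m h"
    and eq: "\<And>i. i < m \<Longrightarrow> g (unit_vec m i) = h (unit_vec m i)"
    and v: "v \<in> carrier_vec m"
  shows "g v = h v"
proof -
  have "g (vec m (\<lambda>i. if i < k then v $ i else 0)) = h (vec m (\<lambda>i. if i < k then v $ i else 0))"
    if "k \<le> m" for k
    using that
  proof (induction k)
    case 0
    have z: "vec m (\<lambda>i. if i < 0 then v $ i else 0) = 0 \<cdot>\<^sub>v (0\<^sub>v m :: real vec)"
      by (intro eq_vecI) auto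
    show ?case
    proof -
      have "f (0 \<cdot>\<^sub>v (0\<^sub>v m)) = 0" if "linear_form_on_vec m f" for f
        using that unfolding linear_form_on_vec_def by (metis mult_zero_left zero_carrier_vec)
      then show ?thesis unfolding z using assms(1,2) by metis
    qed
  next
    case (Suc k)
    let ?w = "vec m (\<lambda>i. if i < k then v $ i else 0)"
    have z: "vec m (\<lambda>i. if i < Suc k then v $ i else 0) = ?w + v $ k \<cdot>\<^sub>v unit_vec m k"
      using Suc.prems by (intro eq_vecI) (auto simp: less_Suc_eq)
    have step: "f (?w + v $ k \<cdot>\<^sub>v unit_vec m k) = f ?w + v $ k * f (unit_vec m k)"
      if "linear_form_on_vec m f" for f
      using that by (simp add: linear_form_on_vec_def)
    then show ?case
      unfolding z step[OF assms(1)] step[OF assms(2)] using Suc eq[of k] by simp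
  qed
  moreover have "vec m (\<lambda>i. if i < m then v $ i else 0) = v"
    using v by (intro eq_vecI) auto
  ultimately show ?thesis
    by (metis order_refl)
qed

lemma std_basis_cases:
  assumes "k < 2 * n + 1"
  obtains i where "i < n" "unit_vec (2 * n + 1) k = std_e n i"
    | i where "i < n" "unit_vec (2 * n + 1) k = std_f n i"
    | "unit_vec (2 * n + 1) k = std_xi n"
proof -
  have "(unit_vec (2 * n + 1) k :: real vec) \<in> set (unit_vecs (2 * n + 1))"
    using assms unfolding unit_vecs_def by force
  then show thesis
    unfolding std_basis_eq using that by blast
qed

lemma std_b_unique:
  assumes bil: "bilinear_form_on_vec (2 * n + 1) g"
    and anti: "\<And>u v. u \<in> carrier_vec (2 * n + 1) \<Longrightarrow> v \<in> carrier_vec (2 * n + 1) \<Longrightarrow> g u v = - g v u"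
    and ee: "\<And>i j. i < n \<Longrightarrow> j < n \<Longrightarrow> g (std_e n i) (std_e n j) = 0"
    and ff: "\<And>i j. i < n \<Longrightarrow> j < n \<Longrightarrow> g (std_f n i) (std_f n j) = 0"
    and ef: "\<And>i j. i < n \<Longrightarrow> j < n \<Longrightarrow> g (std_e n i) (std_f n j) = (if i = j then 1 else 0)"
    and xi: "\<And>v. v \<in> carrier_vec (2 * n + 1) \<Longrightarrow> g (std_xi n) v = 0"
    and u: "u \<in> carrier_vec (2 * n + 1)" and v: "v \<in> carrier_vec (2 * n + 1)"
  shows "g u v = std_b n u v"
proof -
  let ?m = "2 * n + 1"
  have car: "std_e n i \<in> carrier_vec ?m" "std_f n i \<in> carrier_vec ?m" "std_xi n \<in> carrier_vec ?m" for i
    by (auto simp: std_e_def std_f_def std_xi_def)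
  have xi': "g w (std_xi n) = 0" if "w \<in> carrier_vec ?m" for w
    using anti[OF that car(3)] xi[OF that] by simp
  have sxi': "std_b n w (std_xi n) = 0" for w
    using std_b_antisym[of n w "std_xi n"] std_b_xi[of n w] by simp
  have fe: "g (std_f n i) (std_e n j) = std_b n (std_f n i) (std_e n j)" if "i < n" "j < n" for i j
    using anti[OF car(2,1)] std_b_antisym[of n "std_f n i" "std_e n j"] ef that std_b_basis(3)
    by metis
  have basis: "g (unit_vec ?m k) (unit_vec ?m l) = std_b n (unit_vec ?m k) (unit_vec ?m l)"
    if k: "k < ?m" and l: "l < ?m" for k l
    by (rule std_basis_cases[OF k]; rule std_basis_cases[OF l];
        simp only: ee ff ef fe xi xi' sxi' std_b_xi std_b_basis car)
  have left: "g (unit_vec ?m k) v = std_b n (unit_vec ?m k) v" if k: "k < ?m" for k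
    by (rule linear_form_on_vec_eqI[where g = "g (unit_vec ?m k)" and h = "std_b n (unit_vec ?m k)",
          OF _ _ basis[OF k] v])
      (use bil std_b_form[of n] in \<open>auto simp: bilinear_form_on_vec_def\<close>)
  show ?thesis
    by (rule linear_form_on_vec_eqI[where g = "\<lambda>w. g w v" and h = "\<lambda>w. std_b n w v", OF _ _ left u])
      (use bil std_b_form[of n] v in \<open>auto simp: bilinear_form_on_vec_def\<close>)
qed

lemma std_psi_unique:
  assumes lin: "linear_form_on_vec (2 * n + 1) g"
    and xi: "g (std_xi n) = 1"
    and ker: "{v \<in> carrier_vec (2 * n + 1). g v = 0} =
      LinearCombinations.module.span class_ring (module_vec TYPE(real) (2 * n + 1))
        (std_e n ` {..<n} \<union> std_f n ` {..<n})"
    and v: "v \<in> carrier_vec (2 * n + 1)"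
  shows "g v = std_psi n v"
proof (rule linear_form_on_vec_eqI[OF lin std_psi_form _ v])
  fix k assume k: "k < 2 * n + 1"
  have K: "g w = 0 \<longleftrightarrow> std_psi n w = 0" if "w \<in> carrier_vec (2 * n + 1)" for w
    using ker std_psi_kernel[of n] that by blast
  show "g (unit_vec (2 * n + 1) k) = std_psi n (unit_vec (2 * n + 1) k)"
  proof (cases "k = 2 * n")
    case True
    then show ?thesis using xi std_psi_xi by (simp add: std_xi_def)
  next
    case False
    then have "std_psi n (unit_vec (2 * n + 1) k) = 0"
      using k by (simp add: std_psi_def)
    then show ?thesis using K[of "unit_vec (2 * n + 1) k"] by simp
  qed
qed

end

theory Submission
  imports Defs
begin

text \<open>Take a maximal family of hyperbolic pairs \<open>e\<^sub>i, f\<^sub>i\<close> for \<open>b\<close>. Subtracting from a vector its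
  projection to the span of the family leaves a vector in the radical of \<open>b\<close>, as otherwise the
  family could be extended. Injectivity of \<open>v \<mapsto> b(v, \<cdot>) + \<psi>(v) \<psi>\<close> makes \<open>\<psi>\<close> injective on the
  radical, and the radical is nonzero since \<open>V\<close> has odd dimension; so it is spanned by a vector
  \<open>\<xi>\<close> with \<open>\<psi>(\<xi>) = 1\<close>. Subtracting multiples of \<open>\<xi>\<close> moves the pairs into the kernel of \<open>\<psi>\<close>
  without changing the values of \<open>b\<close>.\<close>

section \<open>Splitting of sums and biorthogonal systems\<close>

lemma sum_lessThan_add:
  fixes g :: "nat \<Rightarrow> 'b::comm_monoid_add"
  shows "sum g {..<m + k} = sum g {..<m} + (\<Sum>i<k. g (m + i))"
  by (induction k) (simp_all add: add.assoc)

text \<open>Each \<open>\<phi> i\<close> vanishes on the span of the vectors of the family other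
  than \<open>c i\<close>, but not at \<open>c i\<close> itself.\<close>

lemma biorthogonal_independent:
  fixes c :: "'i \<Rightarrow> 'a::real_vector" and \<phi> :: "'i \<Rightarrow> 'a \<Rightarrow> real"
  assumes lin: "\<And>i. i \<in> I \<Longrightarrow> linear (\<phi> i)"
    and dual: "\<And>i j. i \<in> I \<Longrightarrow> j \<in> I \<Longrightarrow> \<phi> i (c j) = (if i = j then 1 else 0)"
  shows "inj_on c I" and "independent (c ` I)"
proof -
  show inj: "inj_on c I"
    using dual by (intro inj_onI) (metis zero_neq_one)
  show "independent (c ` I)"
    unfolding dependent_def
  proof clarify
    fix i assume i: "i \<in> I" and "c i \<in> span (c ` I - {c i})"
    moreover have "\<phi> i x = 0" if "x \<in> c ` I - {c i}" for x
      using that dual[OF i] by auto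
    ultimately have "\<phi> i (c i) = 0"
      using linear_eq_0_on_span[OF lin[OF i]] by blast
    with dual[OF i i] show False by simp
  qed
qed

text \<open>The expansion makes the independent family \<open>c\<close> a basis, so that counting
  indices gives the dimension.\<close>

lemma biorthogonal_dim:
  fixes c :: "'i \<Rightarrow> 'a::real_vector" and \<phi> :: "'i \<Rightarrow> 'a \<Rightarrow> real"
  assumes lin: "\<And>i. i \<in> I \<Longrightarrow> linear (\<phi> i)"
    and dual: "\<And>i j. i \<in> I \<Longrightarrow> j \<in> I \<Longrightarrow> \<phi> i (c j) = (if i = j then 1 else 0)"
    and expand: "\<And>v. (\<Sum>i\<in>I. \<phi> i v *\<^sub>R c i) = v"
  shows "dim (UNIV :: 'a set) = card I"
proof -
  have "(\<Sum>i\<in>I. \<phi> i v *\<^sub>R c i) \<in> span (c ` I)" for v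
    by (intro span_sum span_scale span_base imageI)
  then have "v \<in> span (c ` I)" for v
    unfolding expand .
  moreover note biorthogonal_independent[of I \<phi> c, OF lin dual]
  ultimately show ?thesis
    by (intro dim_unique[of "c ` I"]) (auto simp: card_image)
qed

section \<open>Hyperbolic pairs of an antisymmetric form\<close>

definition hyperbolic_pairs ::
    "('a \<Rightarrow> 'a \<Rightarrow> real) \<Rightarrow> nat \<Rightarrow> (nat \<Rightarrow> 'a) \<Rightarrow> (nat \<Rightarrow> 'a) \<Rightarrow> bool" where
  "hyperbolic_pairs b m e f \<longleftrightarrow>
     (\<forall>i<m. \<forall>j<m. b (e i) (e j) = 0 \<and> b (f i) (f j) = 0 \<and>
        b (e i) (f j) = (if i = j then 1 else 0))"

text \<open>The order is that of the standard basis, with \<open>z\<close> in the place of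
  \<open>\<xi>\<close>.\<close>

definition pairs_basis :: "nat \<Rightarrow> (nat \<Rightarrow> 'a) \<Rightarrow> (nat \<Rightarrow> 'a) \<Rightarrow> 'a \<Rightarrow> nat \<Rightarrow> 'a" where
  "pairs_basis m e f z i = (if i < m then e i else if i < 2 * m then f (i - m) else z)"

text \<open>Candidates for the functionals dual to \<open>pairs_basis\<close>. Pairing with
  \<open>f i\<close> reads off the coefficient at \<open>e i\<close>; pairing with
  \<open>e i\<close> reads off that at \<open>f i\<close> up to sign.\<close>

definition pairs_coord ::
    "('a \<Rightarrow> 'a \<Rightarrow> real) \<Rightarrow> ('a \<Rightarrow> real) \<Rightarrow> nat \<Rightarrow> (nat \<Rightarrow> 'a) \<Rightarrow> (nat \<Rightarrow> 'a) \<Rightarrow> nat \<Rightarrow> 'a \<Rightarrow> real"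
  where
  "pairs_coord b \<psi> m e f i v =
     (if i < m then b v (f i) else if i < 2 * m then - b v (e (i - m)) else \<psi> v)"

locale antisymmetric_form =
  fixes b :: "'a::real_vector \<Rightarrow> 'a \<Rightarrow> real"
  assumes bilinear: "bilinear b" and antisym: "b u v = - b v u"
begin

lemma linear_right: "linear (b v)" and linear_left: "linear (\<lambda>v. b v w)"
  using bilinear by (auto simp: bilinear_def)

lemmas form_simps =
  linear_add[OF linear_left] linear_diff[OF linear_left] linear_scale[OF linear_left]
  linear_sum[OF linear_left] linear_0[OF linear_left]
  linear_add[OF linear_right] linear_diff[OF linear_right] linear_scale[OF linear_right]
  linear_sum[OF linear_right] linear_0[OF linear_right]

lemma form_self: "b v v = 0"
  using antisym[of v v] by simp

lemma hyperbolic_pairsD: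
  assumes "hyperbolic_pairs b m e f" "i < m" "j < m"
  shows "b (e i) (e j) = 0" "b (f i) (f j) = 0"
    "b (e i) (f j) = (if i = j then 1 else 0)" "b (f i) (e j) = (if i = j then - 1 else 0)"
  using assms antisym[of "f i" "e j"] by (auto simp: hyperbolic_pairs_def)

text \<open>For hyperbolic pairs this is \<open>v\<close> minus its \<open>b\<close>-orthogonal
  projection to their span. The second sum is added because
  \<open>b (f i) (e i) = - 1\<close>.\<close>

definition residual :: "nat \<Rightarrow> (nat \<Rightarrow> 'a) \<Rightarrow> (nat \<Rightarrow> 'a) \<Rightarrow> 'a \<Rightarrow> 'a" where
  "residual m e f v = v - (\<Sum>i<m. b v (f i) *\<^sub>R e i) + (\<Sum>i<m. b v (e i) *\<^sub>R f i)"

lemma residual_orthogonal: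
  assumes "hyperbolic_pairs b m e f" "j < m"
  shows "b (residual m e f v) (e j) = 0" "b (residual m e f v) (f j) = 0"
proof -
  note D = hyperbolic_pairsD[OF assms(1) _ assms(2)]
  have "(\<Sum>i<m. b v (f i) * b (e i) (e j)) = 0" "(\<Sum>i<m. b v (e i) * b (f i) (f j)) = 0"
    using D by (auto intro!: sum.neutral)
  \<comment> \<open>Only the term \<open>i = j\<close> survives; it cancels \<open>b v (e j)\<close>
    or \<open>b v (f j)\<close>.\<close>
  moreover have "(\<Sum>i<m. b v (e i) * b (f i) (e j)) = (\<Sum>i<m. if i = j then - b v (e i) else 0)"
    "(\<Sum>i<m. b v (f i) * b (e i) (f j)) = (\<Sum>i<m. if i = j then b v (f i) else 0)"
    by (intro sum.cong; simp add: D)+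
  ultimately show "b (residual m e f v) (e j) = 0" "b (residual m e f v) (f j) = 0"
    using assms(2) by (simp_all add: residual_def form_simps)
qed

lemma hyperbolic_pairs_extend:
  assumes h: "hyperbolic_pairs b m e f"
    and x: "\<And>i. i < m \<Longrightarrow> b x (e i) = 0 \<and> b x (f i) = 0"
    and y: "\<And>i. i < m \<Longrightarrow> b y (e i) = 0 \<and> b y (f i) = 0"
    and xy: "b x y = 1"
  shows "hyperbolic_pairs b (Suc m) (e(m := x)) (f(m := y))"
proof -
  have "b (e i) x = 0" "b (f i) x = 0" "b (e i) y = 0" "b (f i) y = 0" if "i < m" for i
    using x[OF that] y[OF that] antisym[of _ x] antisym[of _ y] by (metis neg_0_equal_iff_equal)+
  with x y xy hyperbolic_pairsD[OF h] show ?thesis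
    by (auto simp: hyperbolic_pairs_def less_Suc_eq form_self)
qed

text \<open>The vectors \<open>e i\<close> are independent, being biorthogonal to the functionals
  \<open>b _ (f i)\<close>. The bound ensures that a family of maximal length exists.\<close>

lemma hyperbolic_pairs_le:
  fixes S :: "'a set"
  assumes "hyperbolic_pairs b m e f" "finite S" "span S = UNIV"
  shows "m \<le> card S"
proof -
  note ind = biorthogonal_independent[of "{..<m}" "\<lambda>i v. b v (f i)" e]
  have *: "inj_on e {..<m}" "independent (e ` {..<m})"
    by (rule ind; use hyperbolic_pairsD[OF assms(1)] in \<open>auto simp: linear_left\<close>)+
  have "card (e ` {..<m}) \<le> card S"
    using independent_span_bound[OF assms(2) *(2)] assms(3) by auto
  with *(1) show ?thesis by (simp add: card_image)
qed

lemma obtain_hyperbolic_pairs: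
  fixes S :: "'a set"
  assumes "finite S" "span S = UNIV"
  obtains m e f where "hyperbolic_pairs b m e f" "\<And>v w. b (residual m e f v) w = 0"
proof -
  define P where "P m \<longleftrightarrow> (\<exists>e f. hyperbolic_pairs b m e f)" for m
  have "P 0" by (simp add: P_def hyperbolic_pairs_def)
  moreover have bound: "\<forall>m. P m \<longrightarrow> m \<le> card S"
    using hyperbolic_pairs_le[OF _ assms] by (auto simp: P_def)
  ultimately have "P (Greatest P)" and max: "\<And>m. P m \<Longrightarrow> m \<le> Greatest P"
    using GreatestI_nat[of P 0 "card S"] Greatest_le_nat[of P _ "card S"] by blast+
  then obtain m e f where m: "m = Greatest P" and h: "hyperbolic_pairs b m e f"
    by (auto simp: P_def)
  let ?r = "residual m e f"
  note orth = residual_orthogonal[OF h]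
  have rr: "b (?r v) (?r w) = 0" for v w
  proof (rule ccontr)
    assume nz: "b (?r v) (?r w) \<noteq> 0"
    \<comment> \<open>Both residuals are orthogonal to the old pairs; rescaling one gives the
      pairing the value 1, against maximality.\<close>
    have "hyperbolic_pairs b (Suc m) (e(m := (1 / b (?r v) (?r w)) *\<^sub>R ?r v)) (f(m := ?r w))"
      using nz by (intro hyperbolic_pairs_extend[OF h]) (auto simp: form_simps orth)
    then have "Suc m \<le> m"
      unfolding m by (intro max) (auto simp: P_def)
    then show False by simp
  qed
  have "b (?r v) w = 0" for v w
  proof -
    \<comment> \<open>\<open>w\<close> differs from its residual by a combination of the pairs, to
      which \<open>?r v\<close> is orthogonal.\<close>
    have "b (?r v) w = b (?r v) (?r w + (\<Sum>i<m. b w (f i) *\<^sub>R e i) - (\<Sum>i<m. b w (e i) *\<^sub>R f i))"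
      by (rule arg_cong[of _ _ "b (?r v)"]) (simp add: residual_def)
    also have "\<dots> = 0"
      by (simp add: form_simps rr orth)
    finally show ?thesis .
  qed
  with h that show thesis by blast
qed

lemma linear_pairs_coord: "linear \<psi> \<Longrightarrow> linear (pairs_coord b \<psi> m e f i)"
  by (cases "i < m"; cases "i < 2 * m")
    (simp_all add: pairs_coord_def[abs_def] linear_left linear_compose_neg)

lemma pairs_coord_dual:
  assumes h: "hyperbolic_pairs b m e f" and "i < 2 * m" "j < 2 * m"
  shows "pairs_coord b \<psi> m e f i (pairs_basis m e f z j) = (if i = j then 1 else 0)"
  using assms(2,3) hyperbolic_pairsD[OF h]
  by (auto simp: pairs_coord_def pairs_basis_def)

lemma pairs_sum_add_residual:
  "(\<Sum>i<2 * m. pairs_coord b \<psi> m e f i v *\<^sub>R pairs_basis m e f z i) + residual m e f v = v"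
  by (simp add: residual_def mult_2 sum_lessThan_add pairs_coord_def pairs_basis_def sum_negf)

end

section \<open>Radical and Darboux basis of a cosymplectic space\<close>

lemma cosymplectic_spaceD:
  assumes "cosymplectic_space b \<psi>"
  shows "antisymmetric_form b" "linear \<psi>" "inj (\<lambda>v u. b v u + \<psi> v * \<psi> u)"
  using assms unfolding cosymplectic_space_def antisymmetric_form_def bij_betw_def by blast+

text \<open>Such a \<open>k\<close> has the same image as 0 under the injective map to the dual.
  Hence vectors of the radical are determined by their value under \<open>\<psi>\<close>.\<close>

lemma cosymplectic_radical_eq_0:
  assumes "cosymplectic_space b \<psi>" "\<And>w. b k w = 0" "\<psi> k = 0"
  shows "k = 0"
proof -
  interpret antisymmetric_form b
    by (rule cosymplectic_spaceD[OF assms(1)])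
  have "(\<lambda>u. b k u + \<psi> k * \<psi> u) = (\<lambda>u. b 0 u + \<psi> 0 * \<psi> u)"
    using assms(2,3) by (simp add: form_simps linear_0[OF cosymplectic_spaceD(2)[OF assms(1)]])
  then show ?thesis
    by (rule injD[OF cosymplectic_spaceD(3)[OF assms(1)]])
qed

lemma obtain_darboux_basis:
  fixes b :: "'a::real_vector \<Rightarrow> 'a \<Rightarrow> real"
  assumes cos: "cosymplectic_space b \<psi>" and odd: "odd (dim (UNIV :: 'a set))"
  obtains m e f \<xi> where "hyperbolic_pairs b m e f"
    "\<And>i. i < m \<Longrightarrow> \<psi> (e i) = 0" "\<And>i. i < m \<Longrightarrow> \<psi> (f i) = 0"
    "\<psi> \<xi> = 1" "\<And>w. b \<xi> w = 0"
    "\<And>v. (\<Sum>i<2 * m + 1. pairs_coord b \<psi> m e f i v *\<^sub>R pairs_basis m e f \<xi> i) = v"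
proof -
  interpret antisymmetric_form b
    by (rule cosymplectic_spaceD[OF cos])
  note lin = cosymplectic_spaceD(2)[OF cos]
  have "\<exists>S::'a set. finite S \<and> span S = UNIV"
    using cos unfolding cosymplectic_space_def by blast
  then obtain m e' f' where h': "hyperbolic_pairs b m e' f'"
    and rad': "\<And>v w. b (residual m e' f' v) w = 0"
    using obtain_hyperbolic_pairs by metis
  \<comment> \<open>If all residuals vanished, the pairs would form a basis of even size
    \<open>2 * m\<close>. The value \<open>z = 0\<close> is a filler, as the indices stay below
    \<open>2 * m\<close>.\<close>
  have "\<exists>v. residual m e' f' v \<noteq> 0"
  proof (rule ccontr)
    assume "\<not> ?thesis"
    then have "dim (UNIV :: 'a set) = card {..<2 * m}"
      using pairs_sum_add_residual[where \<psi> = \<psi> and z = 0 and m = m and e = e' and f = f']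
      by (intro biorthogonal_dim[of _ "pairs_coord b \<psi> m e' f'" "pairs_basis m e' f' 0"])
        (auto simp: linear_pairs_coord lin pairs_coord_dual[OF h'])
    with odd show False by simp
  qed
  then obtain k where k: "k \<noteq> 0" "\<And>w. b k w = 0"
    using rad' by blast
  then have "\<psi> k \<noteq> 0"
    using cosymplectic_radical_eq_0[OF cos] by blast
  define \<xi> where "\<xi> = (1 / \<psi> k) *\<^sub>R k"
  have \<xi>: "\<psi> \<xi> = 1" "b \<xi> w = 0" "b w \<xi> = 0" for w
    using \<open>\<psi> k \<noteq> 0\<close> k(2) antisym[of w k] by (auto simp: \<xi>_def linear_scale[OF lin] form_simps)
  \<comment> \<open>The projection to the kernel of \<open>\<psi>\<close> along
    \<open>\<xi>\<close>; it preserves \<open>b\<close> since \<open>\<xi>\<close> lies in the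
    radical.\<close>
  define p where "p v = v - \<psi> v *\<^sub>R \<xi>" for v
  have p: "\<psi> (p v) = 0" "b (p v) w = b v w" "b w (p v) = b w v" for v w
    using \<xi> by (auto simp: p_def linear_diff[OF lin] linear_scale[OF lin] form_simps)
  define e f where "e = p \<circ> e'" and "f = p \<circ> f'"
  have h: "hyperbolic_pairs b m e f"
    using h' by (simp add: hyperbolic_pairs_def e_def f_def p)
  have \<psi>ef: "\<psi> (e i) = 0" "\<psi> (f i) = 0" for i
    by (simp_all add: e_def f_def p)
  \<comment> \<open>Both sides lie in the radical and have the same value under
    \<open>\<psi>\<close>.\<close>
  have res: "residual m e f v = \<psi> v *\<^sub>R \<xi>" for v
  proof -
    have "b (residual m e f v) w = b (residual m e' f' v) w" for w
      by (simp add: residual_def form_simps e_def f_def p)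
    then have rad: "b (residual m e f v) w = 0" for w
      using rad' by simp
    have "\<psi> (residual m e f v) = \<psi> v"
      by (simp add: residual_def linear_diff[OF lin] linear_add[OF lin] linear_sum[OF lin]
          linear_scale[OF lin] \<psi>ef)
    then have "residual m e f v - \<psi> v *\<^sub>R \<xi> = 0"
      by (intro cosymplectic_radical_eq_0[OF cos])
        (simp_all add: rad \<xi> form_simps linear_diff[OF lin] linear_scale[OF lin])
    then show ?thesis by simp
  qed
  \<comment> \<open>The residual is exactly the term with index \<open>2 * m\<close>.\<close>
  have "(\<Sum>i<2 * m + 1. pairs_coord b \<psi> m e f i v *\<^sub>R pairs_basis m e f \<xi> i) = v" for v
    using pairs_sum_add_residual[where \<psi> = \<psi> and z = \<xi> and m = m and e = e and f = f and v = v]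
    by (simp add: res pairs_coord_def[where i = "2 * m"] pairs_basis_def[where i = "2 * m"])
  with h \<psi>ef \<xi> that show thesis by blast
qed

theorem proposition2p15:
  fixes b :: "'a::real_vector \<Rightarrow> 'a \<Rightarrow> real" and \<psi> :: "'a \<Rightarrow> real" and n :: nat
  assumes "cosymplectic_space b \<psi>"
    and "dim (UNIV :: 'a set) = 2 * n + 1"
  shows "\<exists>B :: 'a \<Rightarrow> real vec. linear_iso_to_vec (2 * n + 1) B \<and>
           (\<forall>u v. std_b n (B u) (B v) = b u v) \<and> (\<forall>v. std_psi n (B v) = \<psi> v)"
proof (rule obtain_darboux_basis[OF assms(1)])
  show "odd (dim (UNIV :: 'a set))"
    using assms(2) by simp
next
  fix m e f \<xi>
  assume h: "hyperbolic_pairs b m e f"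
    and \<psi>ef: "\<And>i. i < m \<Longrightarrow> \<psi> (e i) = 0" "\<And>i. i < m \<Longrightarrow> \<psi> (f i) = 0"
    and \<xi>: "\<psi> \<xi> = 1" "\<And>w. b \<xi> w = 0"
    and exp: "\<And>v. (\<Sum>i<2 * m + 1. pairs_coord b \<psi> m e f i v *\<^sub>R pairs_basis m e f \<xi> i) = v"
  interpret antisymmetric_form b
    by (rule cosymplectic_spaceD[OF assms(1)])
  note lin = cosymplectic_spaceD(2)[OF assms(1)]
  let ?\<phi> = "pairs_coord b \<psi> m e f" and ?c = "pairs_basis m e f \<xi>"
  note lin\<phi> = linear_pairs_coord[OF lin, of m e f]
  have dual: "?\<phi> i (?c j) = (if i = j then 1 else 0)" if "i < 2 * m + 1" "j < 2 * m + 1" for i j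
  proof (cases "i < 2 * m \<and> j < 2 * m")
    case True
    then show ?thesis using pairs_coord_dual[OF h] by blast
  next
    \<comment> \<open>One index is \<open>2 * m\<close>: \<open>\<psi>\<close> vanishes on the pairs
      and \<open>\<xi>\<close> is in the radical.\<close>
    case False
    with that show ?thesis
      by (auto simp: pairs_coord_def pairs_basis_def \<xi> \<psi>ef less_Suc_eq)
  qed
  have "dim (UNIV :: 'a set) = card {..<2 * m + 1}"
    by (rule biorthogonal_dim[of _ ?\<phi> ?c]) (use lin\<phi> dual exp in auto)
  with assms(2) have mn: "m = n" by simp
  \<comment> \<open>\<open>B\<close> takes coordinates in the Darboux basis, and \<open>C\<close>
    rebuilds the vector from them.\<close>
  define B where "B v = vec (2 * n + 1) (\<lambda>i. ?\<phi> i v)" for v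
  define C where "C x = (\<Sum>i<2 * n + 1. (x $ i) *\<^sub>R ?c i)" for x
  have CB: "C (B v) = v" for v
    using exp[of v] by (simp add: B_def C_def mn)
  have BC: "B (C x) = x" if "x \<in> carrier_vec (2 * n + 1)" for x
  proof (rule eq_vecI)
    fix i assume "i < dim_vec x"
    with that have i: "i < 2 * n + 1" by simp
    have "B (C x) $ i = (\<Sum>j<2 * n + 1. x $ j * ?\<phi> i (?c j))"
      using i by (simp add: B_def C_def linear_sum[OF lin\<phi>] linear_scale[OF lin\<phi>] linear_add[OF lin\<phi>])
    also have "\<dots> = (\<Sum>j<2 * n + 1. if j = i then x $ j else 0)"
      using i dual mn by (intro sum.cong) auto
    also have "\<dots> = x $ i" using i by simp
    finally show "B (C x) $ i = x $ i" .
  qed (use that in \<open>simp add: B_def\<close>)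
  have "bij_betw B UNIV (carrier_vec (2 * n + 1))"
    by (rule bij_betw_byWitness[of _ C]) (auto simp: CB BC, auto simp: B_def)
  moreover have "B (u + v) = B u + B v" "B (r *\<^sub>R v) = r \<cdot>\<^sub>v B v" for u v r
    by (auto simp: B_def linear_add[OF lin\<phi>] linear_scale[OF lin\<phi>] intro!: eq_vecI)
  ultimately have "linear_iso_to_vec (2 * n + 1) B"
    by (auto simp: linear_iso_to_vec_def)
  moreover have "std_b n (B u) (B v) = b u v" for u v
  proof -
    have b\<xi>: "b u \<xi> = 0" using \<xi>(2) antisym[of u \<xi>] by simp
    \<comment> \<open>It suffices to expand \<open>v\<close>: the values \<open>b u (e i)\<close>
      and \<open>b u (f i)\<close> are, up to sign, already coordinates of \<open>u\<close>.\<close>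
    have "b u v = b u (\<Sum>i<2 * n + 1. ?\<phi> i v *\<^sub>R ?c i)"
      unfolding mn[symmetric] by (rule arg_cong[OF exp[symmetric]])
    also have "\<dots> = (\<Sum>i<n. b v (f i) * b u (e i)) - (\<Sum>i<n. b v (e i) * b u (f i))"
      by (simp add: form_simps mn mult_2 sum_lessThan_add pairs_coord_def pairs_basis_def b\<xi> sum_negf)
    also have "\<dots> = std_b n (B u) (B v)"
      by (simp add: std_b_def B_def mn pairs_coord_def sum_subtractf sum_negf mult.commute)
    finally show ?thesis by simp
  qed
  moreover have "std_psi n (B v) = \<psi> v" for v
    by (simp add: std_psi_def B_def pairs_coord_def mn)
  ultimately show ?thesis by blast
qed

end
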